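(* Let $X$ be a compact metric space and let $f\colon X\to X$ be a continuous map such that $X$ is connected and the chain recurrent set $CR(f)$ is totally disconnected. Then the following conditions are equivalent: (a) $X=LSC(\omega_f)$, i.e. the set-valued map $\omega_f$ is lower semicontinuous at every point of $X$; (b) $X=CC(f)$, i.e. $f$ is chain continuous at every point of $X$.
   Context: $(X,d)$ is a compact metric space, $f\colon X\to X$ is continuous, and $\mathcal{K}(X)$ is the set of non-empty closed subsets of $X$. $\omega_f(x)$ is the set of $y\in X$ such that $\lim_{j\to\infty}f^{i_j}(x)=y$ for some $0\le i_1<i_2<\cdots$; $\omega_f$ is regarded as a map $X\to\mathcal{K}(X)$. A map $\phi\colon X\to\mathcal{K}(X)$ is lower semicontinuous at $x$ if for every open $U\subset X$ with $\phi(x)\cap U\ne\emptyset$ there is $\delta>0$ such that $d(x,y)\le\delta$ implies $\phi(y)\cap U\ne\emptyset$ for all $y\in X$. $LSC(\phi)$ is the set of lower semicontinuity points of $\phi$. For $\delta>0$, a finite sequence $(x_i)_{i=0}^k$ in $X$ with $k\ge1$ is a $\delta$-chain of $f$ if $d(f(x_i),x_{i+1})\le\delta$ for $0\le i\le k-1$. $y\rightarrow z$ means that for every $\delta>0$ there is a $\delta$-chain $(x_i)_{i=0}^k$ of $f$ with $x_0=y$ and $x_k=z$. $CR(f)=\{x\in X\colon x\rightarrow x\}$. A sequence $(x_i)_{i\ge0}$ in $X$ is a $\delta$-pseudo orbit of $f$ if $\sup_{i\ge0}d(f(x_i),x_{i+1})\le\delta$. $f$ is chain continuous at $x$ if for every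 $\epsilon>0$ there is $\delta>0$ such that every $\delta$-pseudo orbit $(x_i)_{i\ge0}$ of $f$ with $x_0=x$ satisfies $\sup_{i\ge0}d(x_i,f^i(x))\le\epsilon$; $CC(f)$ is the set of chain continuity points. *)

theory Defs
  imports "HOL-Analysis.Analysis"
begin

text \<open>
  A metric space is a subset \<open>X\<close> of a type of class \<open>metric_space\<close>, with the induced metric,
  and a self-map of \<open>X\<close> is a function \<open>f\<close> with \<open>f \<in> X \<rightarrow> X\<close>; its values outside \<open>X\<close> are
  irrelevant because all points below are required to lie in \<open>X\<close>.
  A condition \<open>sup\<^sub>i a\<^sub>i \<le> c\<close> is written as \<open>\<forall>i. a\<^sub>i \<le> c\<close>.
\<close>

definition totally_disconnected :: "'a::topological_space set \<Rightarrow> bool" where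
  "totally_disconnected S \<longleftrightarrow> (\<forall>x\<in>S. connected_component_set S x = {x})"

definition omega_limit :: "'a::metric_space set \<Rightarrow> ('a \<Rightarrow> 'a) \<Rightarrow> 'a \<Rightarrow> 'a set" where
  "omega_limit X f x =
     {y\<in>X. \<exists>i::nat \<Rightarrow> nat. strict_mono i \<and> (\<lambda>j. (f ^^ i j) x) \<longlonglongrightarrow> y}"

definition lsc_at :: "'a::metric_space set \<Rightarrow> ('a \<Rightarrow> 'a set) \<Rightarrow> 'a \<Rightarrow> bool" where
  "lsc_at X \<phi> x \<longleftrightarrow>
     (\<forall>U. openin (top_of_set X) U \<and> \<phi> x \<inter> U \<noteq> {} \<longrightarrow>
        (\<exists>\<delta>>0. \<forall>y\<in>X. dist x y \<le> \<delta> \<longrightarrow> \<phi> y \<inter> U \<noteq> {}))"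

definition LSC :: "'a::metric_space set \<Rightarrow> ('a \<Rightarrow> 'a set) \<Rightarrow> 'a set" where
  "LSC X \<phi> = {x\<in>X. lsc_at X \<phi> x}"

text \<open>The chain \<open>(x\<^sub>0, \<dots>, x\<^sub>k)\<close> is the restriction of \<open>x\<close> to \<open>{..k}\<close>.\<close>

definition chain_of ::
    "'a::metric_space set \<Rightarrow> ('a \<Rightarrow> 'a) \<Rightarrow> real \<Rightarrow> nat \<Rightarrow> (nat \<Rightarrow> 'a) \<Rightarrow> bool" where
  "chain_of X f \<delta> k x \<longleftrightarrow>
     k \<ge> 1 \<and> (\<forall>i\<le>k. x i \<in> X) \<and> (\<forall>i<k. dist (f (x i)) (x (Suc i)) \<le> \<delta>)"

definition chain_to :: "'a::metric_space set \<Rightarrow> ('a \<Rightarrow> 'a) \<Rightarrow> 'a \<Rightarrow> 'a \<Rightarrow> bool" where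
  "chain_to X f y z \<longleftrightarrow> (\<forall>\<delta>>0. \<exists>k x. chain_of X f \<delta> k x \<and> x 0 = y \<and> x k = z)"

definition CR :: "'a::metric_space set \<Rightarrow> ('a \<Rightarrow> 'a) \<Rightarrow> 'a set" where
  "CR X f = {x\<in>X. chain_to X f x x}"

definition pseudo_orbit ::
    "'a::metric_space set \<Rightarrow> ('a \<Rightarrow> 'a) \<Rightarrow> real \<Rightarrow> (nat \<Rightarrow> 'a) \<Rightarrow> bool" where
  "pseudo_orbit X f \<delta> x \<longleftrightarrow>
     (\<forall>i. x i \<in> X) \<and> (\<forall>i. dist (f (x i)) (x (Suc i)) \<le> \<delta>)"

definition chain_continuous_at :: "'a::metric_space set \<Rightarrow> ('a \<Rightarrow> 'a) \<Rightarrow> 'a \<Rightarrow> bool" where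
  "chain_continuous_at X f x \<longleftrightarrow>
     (\<forall>\<epsilon>>0. \<exists>\<delta>>0. \<forall>xs. pseudo_orbit X f \<delta> xs \<and> xs 0 = x \<longrightarrow>
        (\<forall>i. dist (xs i) ((f ^^ i) x) \<le> \<epsilon>))"

definition CC :: "'a::metric_space set \<Rightarrow> ('a \<Rightarrow> 'a) \<Rightarrow> 'a set" where
  "CC X f = {x\<in>X. chain_continuous_at X f x}"

end

theory Submission
  imports Defs
begin

text \<open>
  Chain continuity always implies that nearby points have uniformly close orbits, hence lower
  semicontinuity of the \<open>\<omega>\<close>-limit map.

  Conversely, let \<open>R\<close> be the set of points reachable from \<open>p\<close> by \<open>\<delta>\<close>-chains. It is trapping: the
  image of its closure lies in an open set \<open>V \<subseteq> R\<close>, so every \<open>\<omega>\<close>-limit set either meets \<open>V\<close> or meets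
  the complement of the closure of \<open>R\<close>, but not both. Lower semicontinuity makes both alternatives
  open, and \<open>p\<close> satisfies the first one, so by connectedness and compactness \<open>f\<^sup>N(X) \<subseteq> R\<close> for some \<open>N\<close>.
  Choosing \<open>p\<close> in \<open>A = \<Inter>\<^sub>n f\<^sup>n(X)\<close> gives \<open>A \<subseteq> CR(f)\<close>. Being a decreasing intersection of compact
  connected sets, \<open>A\<close> is connected, hence a single point, to which \<open>f\<^sup>n\<close> then converges uniformly.
  A pseudo orbit follows true orbits for any prescribed finite time, so uniform convergence to
  a point yields chain continuity.
\<close>

section \<open>Decreasing sequences of compact sets\<close>

lemma compact_nest_subset_open:
  fixes C :: "nat \<Rightarrow> 'a::metric_space set"
  assumes comp: "\<And>n. compact (C n)" and dec: "decseq C"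
    and U: "open U" "(\<Inter>n. C n) \<subseteq> U"
  shows "\<exists>n. C n \<subseteq> U"
proof (rule ccontr)
  assume "\<not> ?thesis"
  then have ne: "C n - U \<noteq> {}" for n
    by auto
  have sub: "C n \<subseteq> C 0" for n
    using dec by (simp add: decseqD)
  have "(\<Inter>n. C n - U) \<noteq> {}"
  proof (rule compact_space_imp_nest)
    show "compact_space (top_of_set (C 0))"
      by (simp add: comp compact_space_subtopology)
    show "closedin (top_of_set (C 0)) (C n - U)" for n
      using sub[of n] U(1) comp[of n]
      by (intro closed_subset closed_Diff compact_imp_closed) auto
    show "decseq (\<lambda>n. C n - U)"
      using dec by (force simp: decseq_def)
  qed (rule ne)
  then show False
    using U(2) by auto
qed

text \<open>A separation of the intersection into two closed pieces extends to disjoint open sets;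
  some \<open>C n\<close> already lies in their union and meets both, contradicting its
  connectedness.\<close>

lemma connected_compact_nest:
  fixes C :: "nat \<Rightarrow> 'a::metric_space set"
  assumes comp: "\<And>n. compact (C n)" and conn: "\<And>n. connected (C n)" and dec: "decseq C"
  shows "connected (\<Inter>n. C n)"
  unfolding connected_closed
proof (rule notI, elim exE conjE)
  fix A B
  let ?I = "\<Inter>n. C n"
  assume AB: "closed A" "closed B" "?I \<subseteq> A \<union> B" "A \<inter> B \<inter> ?I = {}"
    "A \<inter> ?I \<noteq> {}" "B \<inter> ?I \<noteq> {}"
  have clI: "closed ?I"
    using comp by (intro closed_INT ballI compact_imp_closed) auto
  \<comment> \<open>Being strictly nearer to one piece than to the other is an open condition, and
    the two conditions exclude each other.\<close>
  define U where "U = {x. infdist x (A \<inter> ?I) < infdist x (B \<inter> ?I)}"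
  define V where "V = {x. infdist x (B \<inter> ?I) < infdist x (A \<inter> ?I)}"
  have oUV: "open U" "open V"
    by (auto simp: U_def V_def intro!: open_Collect_less continuous_intros)
  have cl: "closed (A \<inter> ?I)" "closed (B \<inter> ?I)"
    using AB(1,2) clI by (auto simp only: closed_Int)
  have AU: "A \<inter> ?I \<subseteq> U"
  proof
    fix x
    assume x: "x \<in> A \<inter> ?I"
    then have "x \<notin> B \<inter> ?I"
      using AB(4) by blast
    then show "x \<in> U"
      using infdist_pos_not_in_closed[OF cl(2) AB(6)] infdist_zero[OF x] by (simp add: U_def)
  qed
  have BV: "B \<inter> ?I \<subseteq> V"
  proof
    fix x
    assume x: "x \<in> B \<inter> ?I"
    then have "x \<notin> A \<inter> ?I"
      using AB(4) by blast
    then show "x \<in> V"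
      using infdist_pos_not_in_closed[OF cl(1) AB(5)] infdist_zero[OF x] by (simp add: V_def)
  qed
  have disj: "U \<inter> V = {}"
    by (auto simp: U_def V_def)
  obtain n where n: "C n \<subseteq> U \<union> V"
    using compact_nest_subset_open[OF comp dec, of "U \<union> V"] AU BV oUV AB(3) by blast
  have "U \<inter> C n \<noteq> {}" "V \<inter> C n \<noteq> {}"
    using AU BV AB(5,6) by blast+
  then show False
    using conn[of n] n disj oUV unfolding connected_def by blast
qed

section \<open>Iterates and omega-limit sets\<close>

locale compact_self_map =
  fixes X :: "'a::metric_space set" and f :: "'a \<Rightarrow> 'a"
  assumes compact: "compact X" and maps: "f \<in> X \<rightarrow> X" and cont: "continuous_on X f"
begin

lemma funpow_in: "x \<in> X \<Longrightarrow> (f ^^ n) x \<in> X"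
  using maps by (induction n) auto

lemma continuous_on_funpow: "continuous_on X (f ^^ n)"
proof (induction n)
  case (Suc n)
  have "(f ^^ n) ` X \<subseteq> X"
    using funpow_in by blast
  then show ?case
    using continuous_on_compose[OF Suc] cont continuous_on_subset by (metis funpow.simps(2))
qed (simp add: id_def)

lemma omega_limitI:
  assumes "x \<in> X" "strict_mono i" "(\<lambda>j. (f ^^ i j) x) \<longlonglongrightarrow> y"
  shows "y \<in> omega_limit X f x"
proof -
  have "y \<in> X"
    by (rule closed_sequentially[OF compact_imp_closed[OF compact] _ assms(3)])
      (rule funpow_in[OF assms(1)])
  then show ?thesis
    using assms by (auto simp: omega_limit_def)
qed

text \<open>The times \<open>i\<close> are prescribed so that a limit point of one orbit can be
  compared with the limit of another orbit along the same times.\<close>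

lemma omega_limit_subsequence:
  fixes i :: "nat \<Rightarrow> nat"
  assumes "x \<in> X" "strict_mono i"
  obtains r y where "strict_mono r" "(\<lambda>j. (f ^^ i (r j)) x) \<longlonglongrightarrow> y" "y \<in> omega_limit X f x"
proof -
  have "\<forall>j. (f ^^ i j) x \<in> X"
    using assms funpow_in by blast
  then obtain y r where "strict_mono r" "((\<lambda>j. (f ^^ i j) x) \<circ> r) \<longlonglongrightarrow> y"
    using compact[unfolded compact_eq_seq_compact_metric seq_compact_def,
        THEN spec, of "\<lambda>j. (f ^^ i j) x"] by auto
  then have "strict_mono (i \<circ> r)" "(\<lambda>j. (f ^^ (i \<circ> r) j) x) \<longlonglongrightarrow> y"
    using assms(2) by (auto simp: strict_mono_def comp_def)
  then show thesis
    using that[OF \<open>strict_mono r\<close>] omega_limitI[OF assms(1)] by simp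
qed

lemma omega_limit_nonempty: "x \<in> X \<Longrightarrow> omega_limit X f x \<noteq> {}"
  using omega_limit_subsequence[of x id] by (auto simp: strict_mono_def)

lemma omega_limit_invariant:
  assumes "x \<in> X" "y \<in> omega_limit X f x"
  shows "f y \<in> omega_limit X f x"
proof -
  obtain i where i: "strict_mono i" "(\<lambda>j. (f ^^ i j) x) \<longlonglongrightarrow> y" and y: "y \<in> X"
    using assms by (auto simp: omega_limit_def)
  have "(\<lambda>j. f ((f ^^ i j) x)) \<longlonglongrightarrow> f y"
    using continuous_on_tendsto_compose[OF cont i(2) y] funpow_in[OF assms(1)] by auto
  then show ?thesis
    using i(1) by (intro omega_limitI[OF assms(1), of "\<lambda>j. Suc (i j)"]) (auto simp: strict_mono_def)
qed

lemma omega_limit_meets_open: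
  assumes "x \<in> X" "openin (top_of_set X) V" "omega_limit X f x \<inter> V \<noteq> {}"
  shows "\<exists>n. (f ^^ n) x \<in> V"
proof -
  obtain T where T: "open T" "V = X \<inter> T"
    using assms(2) by (auto simp: openin_open)
  obtain y i where "y \<in> T" "(\<lambda>j. (f ^^ i j) x) \<longlonglongrightarrow> y"
    using assms(3) T by (auto simp: omega_limit_def)
  then have "\<forall>\<^sub>F j in sequentially. (f ^^ i j) x \<in> T"
    using T(1) topological_tendstoD by blast
  then show ?thesis
    using T(2) funpow_in[OF assms(1)] by (auto simp: eventually_sequentially)
qed

lemma omega_limit_subset_closure:
  assumes "\<And>n. n \<ge> N \<Longrightarrow> (f ^^ n) x \<in> R"
  shows "omega_limit X f x \<subseteq> closure R"
proof
  fix y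
  assume "y \<in> omega_limit X f x"
  then obtain i where i: "strict_mono i" "(\<lambda>j. (f ^^ i j) x) \<longlonglongrightarrow> y"
    by (auto simp: omega_limit_def)
  have "(f ^^ i j) x \<in> closure R" if "j \<ge> N" for j
    using assms[of "i j"] closure_subset[of R] seq_suble[OF i(1), of j] that by fastforce
  then have "\<forall>\<^sub>F j in sequentially. (f ^^ i j) x \<in> closure R"
    unfolding eventually_sequentially by blast
  then show "y \<in> closure R"
    using Lim_in_closed_set[OF closed_closure _ _ i(2)] by simp
qed

section \<open>Lower semicontinuity and reachability by chains\<close>

lemma openin_omega_limit_meets:
  assumes "LSC X (omega_limit X f) = X" "openin (top_of_set X) U"
  shows "openin (top_of_set X) {y\<in>X. omega_limit X f y \<inter> U \<noteq> {}}"
  unfolding openin_euclidean_subtopology_iff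
proof (intro conjI ballI)
  fix x
  assume x: "x \<in> {y\<in>X. omega_limit X f y \<inter> U \<noteq> {}}"
  then have "lsc_at X (omega_limit X f) x"
    using assms(1) by (auto simp: LSC_def)
  then obtain \<delta> where \<delta>: "\<delta> > 0" "\<forall>y\<in>X. dist x y \<le> \<delta> \<longrightarrow> omega_limit X f y \<inter> U \<noteq> {}"
    using x assms(2) unfolding lsc_at_def by blast
  have "y \<in> {y\<in>X. omega_limit X f y \<inter> U \<noteq> {}}" if "y \<in> X" "dist y x < \<delta>" for y
  proof -
    have "dist x y \<le> \<delta>"
      using that(2) by (simp add: dist_commute)
    then show ?thesis
      using \<delta>(2) that(1) by blast
  qed
  then show "\<exists>e>0. \<forall>y\<in>X. dist y x < e \<longrightarrow> y \<in> {y\<in>X. omega_limit X f y \<inter> U \<noteq> {}}"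
    using \<delta>(1) by blast
qed auto

text \<open>Chains have at least one step, so \<open>p\<close> itself need not be reachable;
  \<open>p\<close> in \<open>reachable \<delta> p\<close> for all positive \<open>\<delta>\<close>
  is chain recurrence of \<open>p\<close>.\<close>

definition reachable :: "real \<Rightarrow> 'a \<Rightarrow> 'a set" where
  "reachable \<delta> p = {z. \<exists>k x. chain_of X f \<delta> k x \<and> x 0 = p \<and> x k = z}"

lemma reachable_subset: "reachable \<delta> p \<subseteq> X"
  by (auto simp: reachable_def chain_of_def)

lemma reachable_start:
  assumes "p \<in> X" "\<delta> \<ge> 0"
  shows "f p \<in> reachable \<delta> p"
proof -
  have "chain_of X f \<delta> 1 (\<lambda>i. if i = 0 then p else f p)"
    using assms maps by (auto simp: chain_of_def)
  then show ?thesis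
    unfolding reachable_def by force
qed

lemma reachable_step:
  assumes "z \<in> reachable \<delta> p" "w \<in> X" "dist (f z) w \<le> \<delta>"
  shows "w \<in> reachable \<delta> p"
proof -
  obtain k x where x: "chain_of X f \<delta> k x" "x 0 = p" "x k = z"
    using assms(1) by (auto simp: reachable_def)
  have "chain_of X f \<delta> (Suc k) (x(Suc k := w))"
    using x assms(2,3) by (auto simp: chain_of_def less_Suc_eq le_Suc_eq)
  then show ?thesis
    using x(2) unfolding reachable_def by force
qed

lemma LSC_imp_funpow_image_subset_reachable:
  assumes lsc: "LSC X (omega_limit X f) = X" and conn: "connected X"
    and p: "p \<in> X" and \<delta>: "\<delta> > 0"
  shows "\<exists>N. (f ^^ N) ` X \<subseteq> reachable \<delta> p"
proof -
  define R where "R = reachable \<delta> p"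
  \<comment> \<open>One more chain step from \<open>R\<close> covers all of \<open>V\<close>, whence
    \<open>V\<close> is contained in \<open>R\<close>; the open balls make \<open>V\<close>
    relatively open.\<close>
  define V where "V = X \<inter> (\<Union>z\<in>R. ball (f z) \<delta>)"
  define P where "P = {y\<in>X. omega_limit X f y \<inter> V \<noteq> {}}"
  define Q where "Q = {y\<in>X. omega_limit X f y \<inter> (X - closure R) \<noteq> {}}"
  have oV: "openin (top_of_set X) V"
    unfolding V_def by (intro openin_open_Int) auto
  have VR: "V \<subseteq> R"
    unfolding V_def R_def using reachable_step by (auto simp: less_imp_le)
  have RX: "R \<subseteq> X"
    unfolding R_def by (rule reachable_subset)
  then have KX: "closure R \<subseteq> X"
    by (simp add: closure_minimal compact compact_imp_closed)
  \<comment> \<open>A point \<open>z\<close> of the closure is replaced by a nearby \<open>y\<close>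
    in \<open>R\<close>, for which continuity puts \<open>f z\<close> within \<open>\<delta>\<close>
    of \<open>f y\<close>.\<close>
  have fK: "f z \<in> V" if "z \<in> closure R" for z
  proof -
    have "z \<in> X"
      using that KX by blast
    then obtain d where d: "d > 0" "\<And>y. y \<in> X \<Longrightarrow> dist y z < d \<Longrightarrow> dist (f y) (f z) < \<delta>"
      using cont \<delta> unfolding continuous_on_iff by metis
    obtain y where "y \<in> R" "dist y z < d"
      using \<open>z \<in> closure R\<close> d(1) closure_approachable by blast
    then show ?thesis
      using d(2) RX maps \<open>z \<in> X\<close> unfolding V_def by (auto simp: Pi_iff)
  qed
  then have fR: "f z \<in> V" if "z \<in> R" for z
    using that closure_subset by blast
  have stayV: "(f ^^ m) y \<in> V" if "(f ^^ n) y \<in> V" "n \<le> m" for m n y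
    using that(2,1) by (induction m rule: dec_induct) (use fR VR in auto)
  have "openin (top_of_set X) (X - closure R)"
    by (simp add: openin_diff closed_subset KX)
  then have oP: "openin (top_of_set X) P" and oQ: "openin (top_of_set X) Q"
    unfolding P_def Q_def by (auto intro!: openin_omega_limit_meets lsc oV)
  \<comment> \<open>A limit point outside the closure of \<open>R\<close> puts \<open>y\<close> in
    \<open>Q\<close>; otherwise its image is again a limit point and lies in
    \<open>V\<close>.\<close>
  have PQ: "X \<subseteq> P \<union> Q"
  proof
    fix y
    assume "y \<in> X"
    moreover obtain w where "w \<in> omega_limit X f y"
      using omega_limit_nonempty \<open>y \<in> X\<close> by blast
    moreover have "w \<in> X"
      using \<open>w \<in> _\<close> by (simp add: omega_limit_def)
    ultimately show "y \<in> P \<union> Q"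
      using fK[of w] omega_limit_invariant[of y w] by (auto simp: P_def Q_def)
  qed
  \<comment> \<open>An orbit that enters \<open>V\<close> stays in \<open>V\<close>, so all its
    limit points lie in the closure of \<open>R\<close>.\<close>
  have disj: "P \<inter> Q = {}"
  proof -
    have "y \<notin> Q" if y: "y \<in> P" for y
    proof -
      obtain n where "(f ^^ n) y \<in> V"
        using y omega_limit_meets_open oV unfolding P_def by blast
      then show ?thesis
        using omega_limit_subset_closure[of n y R] stayV VR by (auto simp: Q_def)
    qed
    then show ?thesis
      by blast
  qed
  have "p \<in> P"
  proof -
    \<comment> \<open>The claim starts at time 1 because \<open>p\<close> need not belong to
      \<open>R\<close>.\<close>
    have "(f ^^ n) p \<in> R" if "n \<ge> 1" for n
      using that
    proof (induction n rule: dec_induct)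
      case base
      show ?case
        using reachable_start p \<delta> by (simp add: R_def)
    qed (use fR VR in auto)
    then have "p \<notin> Q"
      using omega_limit_subset_closure[of 1 p R] by (auto simp: Q_def)
    then show ?thesis
      using PQ p by blast
  qed
  then have "Q = {}"
    using conn oP oQ PQ disj unfolding connected_openin by blast
  then have enter: "\<exists>n. (f ^^ n) y \<in> V" if "y \<in> X" for y
    using that PQ omega_limit_meets_open oV unfolding P_def by blast
  have op: "openin (top_of_set X) {y\<in>X. (f ^^ n) y \<in> V}" for n
  proof -
    have "(f ^^ n) \<in> X \<rightarrow> X"
      using funpow_in by blast
    then have "openin (top_of_set X) (X \<inter> (f ^^ n) -` V)"
      using continuous_openin_preimage[OF continuous_on_funpow _ oV] by blast
    then show ?thesis
      by (simp add: vimage_def Int_def)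
  qed
  then obtain T where T: "\<And>n. open (T n)" "\<And>n. {y\<in>X. (f ^^ n) y \<in> V} = X \<inter> T n"
    unfolding openin_open by metis
  \<comment> \<open>By compactness finitely many entrance times suffice; as orbits never leave
    \<open>V\<close>, the largest of them serves all points.\<close>
  have "X \<subseteq> (\<Union>n. T n)"
    using enter T(2) by blast
  then obtain F where F: "finite F" "X \<subseteq> (\<Union>n\<in>F. T n)"
    by (rule compactE_image[OF compact T(1)])
  have "(f ^^ Max F) y \<in> R" if y: "y \<in> X" for y
  proof -
    obtain n where "n \<in> F" "y \<in> T n"
      using F(2) y by blast
    moreover have "(f ^^ n) y \<in> V"
      using T(2)[of n] \<open>y \<in> T n\<close> y by blast
    ultimately show ?thesis
      using stayV[of n y "Max F"] F(1) VR by auto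
  qed
  then show ?thesis
    unfolding R_def by blast
qed

section \<open>Collapse of the iterated images to a point\<close>

lemma decseq_funpow_image: "decseq (\<lambda>n. (f ^^ n) ` X)"
proof (rule decseq_SucI)
  show "(f ^^ Suc n) ` X \<subseteq> (f ^^ n) ` X" for n
    using maps unfolding funpow_Suc_right image_comp[symmetric] by (intro image_mono) auto
qed

lemma compact_funpow_image: "compact ((f ^^ n) ` X)"
  by (intro compact_continuous_image continuous_on_funpow compact)

lemma LSC_imp_funpow_image_shrinks:
  assumes lsc: "LSC X (omega_limit X f) = X" and conn: "connected X" and ne: "X \<noteq> {}"
    and td: "totally_disconnected (CR X f)"
  shows "\<exists>q. \<forall>\<epsilon>>0. \<exists>N. (f ^^ N) ` X \<subseteq> ball q \<epsilon>"
proof -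
  let ?C = "\<lambda>n. (f ^^ n) ` X"
  let ?A = "\<Inter>n. ?C n"
  have AX: "?A \<subseteq> X"
    by (rule order_trans[OF INF_lower[of 0]]) auto
  have ACR: "?A \<subseteq> CR X f"
  proof
    fix y
    assume y: "y \<in> ?A"
    then have "y \<in> X"
      using AX by blast
    \<comment> \<open>Some \<open>f ^^ N\<close> maps \<open>X\<close> into the set reachable from
      \<open>y\<close>, and \<open>y\<close> lies in the image of every iterate.\<close>
    moreover have "y \<in> reachable \<delta> y" if "\<delta> > 0" for \<delta>
      using LSC_imp_funpow_image_subset_reachable[OF lsc conn \<open>y \<in> X\<close> that] y by blast
    ultimately show "y \<in> CR X f"
      by (auto simp: CR_def chain_to_def reachable_def)
  qed
  \<comment> \<open>With empty intersection, some image would be contained in the open set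
    \<open>{}\<close>.\<close>
  have "?A \<noteq> {}"
    using compact_nest_subset_open[OF compact_funpow_image decseq_funpow_image, of "{}"] ne by auto
  then obtain q where q: "q \<in> ?A"
    by blast
  have "connected (?C n)" for n
    by (intro connected_continuous_image continuous_on_funpow conn)
  then have "connected ?A"
    by (intro connected_compact_nest compact_funpow_image decseq_funpow_image)
  then have "?A \<subseteq> connected_component_set (CR X f) q"
    using connected_component_maximal[OF q] ACR by blast
  then have A: "?A \<subseteq> {q}"
    using td q ACR unfolding totally_disconnected_def by blast
  have "\<exists>N. ?C N \<subseteq> ball q \<epsilon>" if "\<epsilon> > 0" for \<epsilon>
  proof (rule compact_nest_subset_open[OF compact_funpow_image decseq_funpow_image])
    show "?A \<subseteq> ball q \<epsilon>"
      using that by (intro order_trans[OF A]) simp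
  qed simp
  then show ?thesis
    by blast
qed

section \<open>From collapse to chain continuity\<close>

lemma pseudo_orbit_finite_tracking:
  assumes "\<epsilon> > 0"
  shows "\<exists>\<delta>>0. \<forall>xs. pseudo_orbit X f \<delta> xs \<longrightarrow> (\<forall>i\<le>N. dist (xs i) ((f ^^ i) (xs 0)) \<le> \<epsilon>)"
  using assms
proof (induction N arbitrary: \<epsilon>)
  case 0
  then show ?case
    by (intro exI[of _ 1]) auto
next
  case (Suc N)
  have "uniformly_continuous_on X f"
    by (rule compact_uniformly_continuous[OF cont compact])
  then obtain \<eta> where \<eta>: "\<eta> > 0"
    "\<And>x y. x \<in> X \<Longrightarrow> y \<in> X \<Longrightarrow> dist x y < \<eta> \<Longrightarrow> dist (f x) (f y) < \<epsilon>/2"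
    using Suc.prems unfolding uniformly_continuous_on_def by (metis half_gt_zero)
  \<comment> \<open>The bound \<open>\<epsilon>\<close> settles the indices up to \<open>N\<close>,
    and \<open>\<eta>/2\<close> gives the strict inequality of uniform continuity. At the last step
    the image error and the jump contribute \<open>\<epsilon>/2\<close> each.\<close>
  obtain \<delta> where \<delta>: "\<delta> > 0" "\<And>xs i. pseudo_orbit X f \<delta> xs \<Longrightarrow> i \<le> N \<Longrightarrow>
      dist (xs i) ((f ^^ i) (xs 0)) \<le> min \<epsilon> (\<eta>/2)"
    using Suc.IH[of "min \<epsilon> (\<eta>/2)"] Suc.prems \<eta>(1) by auto
  show ?case
  proof (intro exI[of _ "min \<delta> (\<epsilon>/2)"] conjI allI impI)
    fix xs i
    assume xs: "pseudo_orbit X f (min \<delta> (\<epsilon>/2)) xs" and i: "i \<le> Suc N"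
    have track: "dist (xs j) ((f ^^ j) (xs 0)) \<le> min \<epsilon> (\<eta>/2)" if "j \<le> N" for j
      using \<delta>(2)[OF _ that] xs by (auto simp: pseudo_orbit_def)
    show "dist (xs i) ((f ^^ i) (xs 0)) \<le> \<epsilon>"
    proof (cases "i \<le> N")
      case True
      then show ?thesis
        using track by force
    next
      case False
      have "xs N \<in> X" "(f ^^ N) (xs 0) \<in> X"
        using xs funpow_in by (auto simp: pseudo_orbit_def)
      moreover have "dist (xs N) ((f ^^ N) (xs 0)) < \<eta>"
        using track[of N] \<eta>(1) by auto
      ultimately have "dist (f (xs N)) (f ((f ^^ N) (xs 0))) < \<epsilon>/2"
        using \<eta>(2) by blast
      moreover have "dist (f (xs N)) (xs (Suc N)) \<le> \<epsilon>/2"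
        using xs by (auto simp: pseudo_orbit_def)
      ultimately have "dist (xs (Suc N)) (f ((f ^^ N) (xs 0))) \<le> \<epsilon>"
        using dist_triangle[of "xs (Suc N)" "f ((f ^^ N) (xs 0))" "f (xs N)"]
        by (simp add: dist_commute)
      then show ?thesis
        using False i by (simp add: le_Suc_eq)
    qed
  qed (use \<delta>(1) Suc.prems in auto)
qed

lemma chain_continuous_at_if_image_shrinks:
  assumes shrink: "\<And>\<epsilon>. \<epsilon> > 0 \<Longrightarrow> \<exists>N. (f ^^ N) ` X \<subseteq> ball q \<epsilon>" and x: "x \<in> X"
  shows "chain_continuous_at X f x"
  unfolding chain_continuous_at_def
proof (intro allI impI)
  fix \<epsilon> :: real
  assume \<epsilon>: "\<epsilon> > 0"
  obtain N where N: "(f ^^ N) ` X \<subseteq> ball q (\<epsilon>/4)"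
    using shrink[of "\<epsilon>/4"] \<epsilon> by auto
  obtain \<delta> where \<delta>: "\<delta> > 0" "\<And>xs i. pseudo_orbit X f \<delta> xs \<Longrightarrow> i \<le> N \<Longrightarrow>
      dist (xs i) ((f ^^ i) (xs 0)) \<le> \<epsilon>/2"
    using pseudo_orbit_finite_tracking[of "\<epsilon>/2" N] \<epsilon> by auto
  have "dist (xs i) ((f ^^ i) x) \<le> \<epsilon>" if xs: "pseudo_orbit X f \<delta> xs" "xs 0 = x" for xs i
  proof (cases "i \<le> N")
    case True
    then show ?thesis
      using \<delta>(2)[OF xs(1) True] xs(2) \<epsilon> by auto
  next
    case False
    \<comment> \<open>Tracking restarts at index \<open>k\<close>, which leaves exactly
      \<open>N\<close> steps. Both \<open>(f ^^ N) (xs k)\<close> and \<open>(f ^^ i) x\<close> lie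
      in the image of \<open>f ^^ N\<close>, so the errors add up to
      \<open>\<epsilon>/2 + \<epsilon>/4 + \<epsilon>/4\<close>.\<close>
    then obtain k where k: "i = N + k"
      by (metis le_Suc_ex nat_le_linear)
    have "pseudo_orbit X f \<delta> (\<lambda>j. xs (k + j))"
      using xs(1) by (auto simp: pseudo_orbit_def)
    then have "dist (xs i) ((f ^^ N) (xs k)) \<le> \<epsilon>/2"
      using \<delta>(2)[of "\<lambda>j. xs (k + j)" N] k by (simp add: add.commute)
    moreover have "dist q ((f ^^ N) (xs k)) < \<epsilon>/4"
      using image_subset_iff[THEN iffD1, OF N] xs(1) by (simp add: pseudo_orbit_def)
    moreover have "dist q ((f ^^ i) x) < \<epsilon>/4"
      using image_subset_iff[THEN iffD1, OF N] funpow_in[OF x, of k] k by (simp add: funpow_add)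
    ultimately show ?thesis
      using dist_triangle[of "xs i" "(f ^^ i) x" "(f ^^ N) (xs k)"]
        dist_triangle[of "(f ^^ N) (xs k)" "(f ^^ i) x" q]
      by (simp add: dist_commute)
  qed
  then show "\<exists>\<delta>>0. \<forall>xs. pseudo_orbit X f \<delta> xs \<and> xs 0 = x \<longrightarrow>
      (\<forall>i. dist (xs i) ((f ^^ i) x) \<le> \<epsilon>)"
    using \<delta>(1) by blast
qed

section \<open>From chain continuity to lower semicontinuity\<close>

lemma chain_continuous_at_imp_equicontinuous_at:
  assumes "chain_continuous_at X f x" "x \<in> X" "\<epsilon> > 0"
  shows "\<exists>d>0. \<forall>y\<in>X. dist x y \<le> d \<longrightarrow> (\<forall>i\<ge>1. dist ((f ^^ i) y) ((f ^^ i) x) \<le> \<epsilon>)"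
proof -
  obtain \<delta> where \<delta>: "\<delta> > 0" "\<And>xs i. pseudo_orbit X f \<delta> xs \<Longrightarrow> xs 0 = x \<Longrightarrow>
      dist (xs i) ((f ^^ i) x) \<le> \<epsilon>"
    using assms(1,3) unfolding chain_continuous_at_def by metis
  obtain d where d: "d > 0" "\<And>y. y \<in> X \<Longrightarrow> dist y x < d \<Longrightarrow> dist (f y) (f x) < \<delta>"
    using cont assms(2) \<delta>(1) unfolding continuous_on_iff by metis
  have "dist ((f ^^ i) y) ((f ^^ i) x) \<le> \<epsilon>" if y: "y \<in> X" "dist x y \<le> d/2" and i: "i \<ge> 1" for y i
  proof -
    have "dist (f x) (f y) \<le> \<delta>"
      using d(2)[OF y(1)] d(1) y(2) by (simp add: dist_commute)
    \<comment> \<open>Replacing the first point of the orbit of \<open>y\<close> by \<open>x\<close>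
      costs only the distance from \<open>f x\<close> to \<open>f y\<close>. Index 0 then says
      nothing about \<open>y\<close>, hence the restriction to \<open>i \<ge> 1\<close>.\<close>
    then have "pseudo_orbit X f \<delta> (\<lambda>i. if i = 0 then x else (f ^^ i) y)"
      using assms(2) y(1) \<delta>(1) funpow_in[OF y(1)] maps
      by (auto simp: pseudo_orbit_def Pi_iff)
    then show ?thesis
      using \<delta>(2)[of "\<lambda>i. if i = 0 then x else (f ^^ i) y" i] i by auto
  qed
  then show ?thesis
    using d(1) by (intro exI[of _ "d/2"]) auto
qed

lemma chain_continuous_at_imp_lsc_at:
  assumes cc: "chain_continuous_at X f x" and x: "x \<in> X"
  shows "lsc_at X (omega_limit X f) x"
  unfolding lsc_at_def
proof (intro allI impI, elim conjE)
  fix U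
  assume U: "openin (top_of_set X) U" "omega_limit X f x \<inter> U \<noteq> {}"
  then obtain z where z: "z \<in> omega_limit X f x" "z \<in> U"
    by blast
  obtain e where e: "e > 0" "\<And>w. w \<in> X \<Longrightarrow> dist w z < e \<Longrightarrow> w \<in> U"
    using U(1) z(2) unfolding openin_euclidean_subtopology_iff by blast
  obtain i where i: "strict_mono i" "(\<lambda>j. (f ^^ i j) x) \<longlonglongrightarrow> z"
    using z(1) by (auto simp: omega_limit_def)
  obtain d where d: "d > 0" "\<And>y n. y \<in> X \<Longrightarrow> dist x y \<le> d \<Longrightarrow> n \<ge> 1 \<Longrightarrow>
      dist ((f ^^ n) y) ((f ^^ n) x) \<le> e/2"
    using chain_continuous_at_imp_equicontinuous_at[OF cc x, of "e/2"] e(1) by auto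
  have "omega_limit X f y \<inter> U \<noteq> {}" if y: "y \<in> X" "dist x y \<le> d" for y
  proof -
    \<comment> \<open>Thinning the times along which the orbit of \<open>x\<close> tends to
      \<open>z\<close> makes the orbit of \<open>y\<close> converge as well, so \<open>w\<close> and
      \<open>z\<close> are limits along common times.\<close>
    obtain r w where r: "strict_mono r" "(\<lambda>j. (f ^^ i (r j)) y) \<longlonglongrightarrow> w" "w \<in> omega_limit X f y"
      using omega_limit_subsequence[OF y(1) i(1)] by blast
    have "(\<lambda>j. (f ^^ i (r j)) x) \<longlonglongrightarrow> z"
      using LIMSEQ_subseq_LIMSEQ[OF i(2) r(1)] by (simp add: comp_def)
    then have lim: "(\<lambda>j. dist ((f ^^ i (r j)) y) ((f ^^ i (r j)) x)) \<longlonglongrightarrow> dist w z"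
      by (intro tendsto_dist r(2))
    \<comment> \<open>For \<open>j \<ge> 1\<close> the time \<open>i (r j)\<close> is at least 1, as
      the equicontinuity bound requires.\<close>
    have "dist ((f ^^ i (r j)) y) ((f ^^ i (r j)) x) \<le> e/2" if "j \<ge> 1" for j
      using d(2)[OF y] seq_suble[OF r(1), of j] seq_suble[OF i(1), of "r j"] that by force
    then have "dist w z \<le> e/2"
      by (intro LIMSEQ_le_const2[OF lim]) blast
    moreover have "w \<in> X"
      using r(3) by (simp add: omega_limit_def)
    ultimately have "w \<in> U"
      using e by force
    then show ?thesis
      using r(3) by blast
  qed
  then show "\<exists>\<delta>>0. \<forall>y\<in>X. dist x y \<le> \<delta> \<longrightarrow> omega_limit X f y \<inter> U \<noteq> {}"
    using d(1) by blast
qed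

end

theorem theorem6p1:
  fixes X :: "'a::metric_space set" and f :: "'a \<Rightarrow> 'a"
  assumes "compact X"
    and "f \<in> X \<rightarrow> X"
    and "continuous_on X f"
    and "connected X"
    and "totally_disconnected (CR X f)"
  shows "X = LSC X (omega_limit X f) \<longleftrightarrow> X = CC X f"
proof -
  interpret compact_self_map X f
    using assms by unfold_locales
  show ?thesis
  proof
    assume lsc: "X = LSC X (omega_limit X f)"
    \<comment> \<open>\<open>X\<close> may be empty; arguing at a given point supplies the
      nonemptiness that the collapse to a point requires.\<close>
    have "chain_continuous_at X f x" if "x \<in> X" for x
    proof -
      have "X \<noteq> {}"
        using that by blast
      then obtain q where "\<And>\<epsilon>. \<epsilon> > 0 \<Longrightarrow> \<exists>N. (f ^^ N) ` X \<subseteq> ball q \<epsilon>"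
        using LSC_imp_funpow_image_shrinks[OF lsc[symmetric] assms(4) _ assms(5)] by blast
      then show ?thesis
        using chain_continuous_at_if_image_shrinks that by blast
    qed
    then show "X = CC X f"
      by (auto simp: CC_def)
  next
    assume cc: "X = CC X f"
    have "lsc_at X (omega_limit X f) x" if "x \<in> X" for x
    proof -
      have "chain_continuous_at X f x"
        using cc that unfolding CC_def by blast
      then show ?thesis
        by (rule chain_continuous_at_imp_lsc_at[OF _ that])
    qed
    then show "X = LSC X (omega_limit X f)"
      by (auto simp: LSC_def)
  qed
qed

end
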